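(* Let $m\ge 1$ and let $\mathcal{P}$ be an $m$-dimensional integral point set in the Euclidean space $\mathbb{E}^m$. Then all simplices $\mathcal{S}=\{v_0,v_1,\dots,v_m\}\subseteq\mathcal{P}$ with $V_m(\mathcal{S})\neq 0$ have the same characteristic $\mathrm{char}(\mathcal{S})=k$.
   Context: An integral point set in $\mathbb{E}^m$ is a set of points in the $m$-dimensional Euclidean space $\mathbb{E}^m$ whose pairwise distances are all integers. For a set $\mathcal{S}=\{v_0,\dots,v_m\}$ of $m+1$ points in $\mathbb{E}^m$, $V_m(\mathcal{S})$ denotes the $m$-dimensional volume of the simplex with vertices $v_0,\dots,v_m$. It satisfies $$V_m(\mathcal{S})^2=\frac{(-1)^{m+1}}{2^m(m!)^2}\det(\hat{C}),$$ where $\hat{C}$ is the Cayley-Menger matrix, obtained from the $(m+1)\times(m+1)$ matrix $C=(\Vert v_i-v_j\Vert_2^2)_{0\le i,j\le m}$ by bordering it with a top row $(0,1,1,\dots,1)$ and a left column $(0,1,1,\dots,1)^T$. If the pairwise distances of the points of $\mathcal{S}$ are integers, then $V_m(\mathcal{S})^2$ is rational. If moreover $V_m(\mathcal{S})\ne 0$, the characteristic $\mathrm{char}(\mathcal{S})$ is the unique squarefree positive integer $k$ such that $V_m(\mathcal{S})=q\sqrt{k}$ for some $q\in\mathbb{Q}$. *)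

theory Defs
  imports "HOL-Analysis.Analysis" "HOL-Computational_Algebra.Squarefree"
begin

definition integral_point_set :: "'a::metric_space set \<Rightarrow> bool" where
  "integral_point_set P \<longleftrightarrow> (\<forall>x\<in>P. \<forall>y\<in>P. dist x y \<in> \<int>)"

text \<open>The ambient space has dimension \<open>m = DIM('a)\<close>, so the \<open>m\<close>-dimensional volume is
  Lebesgue measure; it is meant for sets of \<open>m + 1\<close> vertices.\<close>
definition simplex_volume :: "'a::euclidean_space set \<Rightarrow> real" where
  "simplex_volume S = measure lebesgue (convex hull S)"

definition has_characteristic :: "'a::euclidean_space set \<Rightarrow> nat \<Rightarrow> bool" where
  "has_characteristic S k \<longleftrightarrow>
     k > 0 \<and> squarefree k \<and> (\<exists>q\<in>\<rat>. simplex_volume S = q * sqrt (real k))"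

text \<open>Only meaningful when the volume is nonzero: for volume zero, every squarefree \<open>k\<close>
  qualifies (with \<open>q = 0\<close>).\<close>
definition characteristic :: "'a::euclidean_space set \<Rightarrow> nat" where
  "characteristic S = (THE k. has_characteristic S k)"

lemma squarefree_times_square_unique:
  fixes a b k l :: nat
  assumes eq: "a\<^sup>2 * k = b\<^sup>2 * l" and "a > 0" "b > 0" and "squarefree k" "squarefree l"
  shows "k = l"
proof (rule multiplicity_eq_nat)
  show k0: "k > 0" and l0: "l > 0"
    using assms(4,5) by (auto intro!: Nat.gr0I)
  fix p :: nat assume p: "prime p"
  have "multiplicity p (a\<^sup>2 * k) = 2 * multiplicity p a + multiplicity p k"
    using p k0 \<open>a > 0\<close>
    by (simp add: prime_elem_multiplicity_mult_distrib prime_elem_multiplicity_power_distrib)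
  moreover have "multiplicity p (b\<^sup>2 * l) = 2 * multiplicity p b + multiplicity p l"
    using p l0 \<open>b > 0\<close>
    by (simp add: prime_elem_multiplicity_mult_distrib prime_elem_multiplicity_power_distrib)
  moreover have "multiplicity p k \<le> 1" "multiplicity p l \<le> 1"
    using assms(4,5) p k0 l0 by (auto simp: squarefree_factorial_semiring'')
  ultimately show "multiplicity p k = multiplicity p l"
    unfolding eq by presburger
qed

lemma has_characteristic_unique:
  assumes "has_characteristic S k" "has_characteristic S l" and nz: "simplex_volume S \<noteq> 0"
  shows "k = l"
proof -
  from assms(1,2) obtain q r where q: "q \<in> \<rat>" "simplex_volume S = q * sqrt (real k)"
    and r: "r \<in> \<rat>" "simplex_volume S = r * sqrt (real l)"
    and kl: "k > 0" "l > 0" "squarefree k" "squarefree l"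
    by (auto simp: has_characteristic_def)
  have nz': "q \<noteq> 0" "r \<noteq> 0" using nz q(2) r(2) by auto
  obtain a b :: nat where ab: "b \<noteq> 0" "\<bar>q\<bar> = real a / real b"
    using Rats_abs_nat_div_natE[OF q(1)] by metis
  obtain c d :: nat where cd: "d \<noteq> 0" "\<bar>r\<bar> = real c / real d"
    using Rats_abs_nat_div_natE[OF r(1)] by metis
  have "(q * sqrt (real k))\<^sup>2 = (r * sqrt (real l))\<^sup>2"
    using q(2) r(2) by simp
  then have "\<bar>q\<bar>\<^sup>2 * k = \<bar>r\<bar>\<^sup>2 * l"
    by (simp add: power_mult_distrib)
  then have "real ((a * d)\<^sup>2 * k) = real ((c * b)\<^sup>2 * l)"
    using ab cd by (simp add: power_divide power_mult_distrib field_simps)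
  then have "(a * d)\<^sup>2 * k = (c * b)\<^sup>2 * l"
    by (simp only: of_nat_eq_iff)
  moreover have "a * d > 0" "c * b > 0"
    using ab cd nz' by (auto intro!: Nat.gr0I)
  ultimately show ?thesis
    using squarefree_times_square_unique kl by blast
qed

lemma characteristic_eqI:
  assumes "has_characteristic S k" "simplex_volume S \<noteq> 0"
  shows "characteristic S = k"
  unfolding characteristic_def using assms has_characteristic_unique by blast

end

theory Submission
  imports Defs
begin

text \<open>Volume and Gram matrix. If a simplex with vertices \<open>v\<^sub>0, \<dots>, v\<^sub>m\<close> has edge matrix \<open>A\<close> with
  columns \<open>v\<^sub>i - v\<^sub>0\<close>, its volume is \<open>\<bar>det A\<bar> / m!\<close>. For a second simplex with edge matrix \<open>B\<close>,
  the product of the two volumes is therefore \<open>\<bar>det (A\<^sup>T B)\<bar> / (m!)\<^sup>2\<close>. The entries of \<open>A\<^sup>T B\<close>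
  are inner products \<open>(v\<^sub>i - v\<^sub>0) \<bullet> (w\<^sub>j - w\<^sub>0)\<close>, and by polarization
  (\<open>inner_diff_diff_eq_dists\<close>) these are half an integer combination of squared distances
  between a vertex of the first simplex and one of the second. So in an integral point set the
  product of the volumes of any two simplices is rational (\<open>simplex_volume_product_rational\<close>).

  Fix a nondegenerate simplex \<open>S\<close>. Taking the second simplex equal to \<open>S\<close> shows that
  the squared volume of \<open>S\<close> is rational, so the volume of \<open>S\<close> is \<open>q \<surd>k\<close> with \<open>k\<close> squarefree. For any other
  simplex \<open>T\<close>, the quotient \<open>V(T) / V(S) = V(S) V(T) / V(S)\<^sup>2\<close> is rational, so
  \<open>V(T)\<close> is a rational multiple of the same \<open>\<surd>k\<close>.

  Determinants require a space \<open>real ^ 'n\<close>, whereas the points lie in an arbitrary Euclidean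
  space. The bridge is a measure-preserving linear isometry onto a coordinate space
  (\<open>measure_preserving_coordinates\<close>).\<close>

section \<open>Coordinates on a Euclidean space\<close>

text \<open>A type with exactly \<open>DIM('a)\<close> elements, to index coordinates of \<open>'a\<close>. It is
  carved out of \<open>nat\<close> rather than taken to be the basis itself so that it inherits a
  well-order, which the change-of-variables theorem for linear maps demands of its index type.\<close>
typedef (overloaded) 'a::euclidean_space coord = "{..<DIM('a)}"
  by (auto intro!: exI[of _ 0])

instantiation coord :: (euclidean_space) "{finite, wellorder}"
begin

definition less_eq_coord :: "'a coord \<Rightarrow> 'a coord \<Rightarrow> bool" where
  "i \<le> j \<longleftrightarrow> Rep_coord i \<le> Rep_coord j"

definition less_coord :: "'a coord \<Rightarrow> 'a coord \<Rightarrow> bool" where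
  "i < j \<longleftrightarrow> Rep_coord i < Rep_coord j"

instance
proof
  show "finite (UNIV :: 'a coord set)"
    using type_definition.Abs_image[OF type_definition_coord]
    by (metis finite_imageI finite_lessThan)
  show "Q i" if "\<And>i. (\<And>j. j < i \<Longrightarrow> Q j) \<Longrightarrow> Q i" for Q and i :: "'a coord"
    using that unfolding less_coord_def by (rule measure_induct_rule)
qed (auto simp: less_eq_coord_def less_coord_def Rep_coord_inject)

end

lemma card_coord: "CARD('a::euclidean_space coord) = DIM('a)"
  using type_definition.card[OF type_definition_coord] by simp

text \<open>Expansion in an orthonormal basis pulls boxes back to boxes with the same side lengths,
  and boxes determine Lebesgue measure.\<close>
lemma measure_preserving_coordinates:
  obtains \<phi> :: "'a::euclidean_space \<Rightarrow> real ^ 'a coord"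
  where "linear \<phi>" "\<And>x y. dist (\<phi> x) (\<phi> y) = dist x y"
    "distr lborel borel \<phi> = lborel"
proof -
  have "card (UNIV :: 'a coord set) = card (Basis :: 'a set)"
    by (rule card_coord)
  then obtain e :: "'a coord \<Rightarrow> 'a" where e: "bij_betw e UNIV Basis"
    using finite_same_card_bij[of "UNIV :: 'a coord set" "Basis :: 'a set"] by auto
  define \<phi> :: "'a \<Rightarrow> real ^ 'a coord" where "\<phi> x = (\<chi> i. x \<bullet> e i)" for x
  have lin: "linear \<phi>"
    by (rule linearI) (auto simp: \<phi>_def vec_eq_iff inner_add_left)
  have inner: "\<phi> x \<bullet> \<phi> y = x \<bullet> y" for x y
  proof -
    have "\<phi> x \<bullet> \<phi> y = (\<Sum>i\<in>UNIV. (x \<bullet> e i) * (y \<bullet> e i))"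
      by (simp add: inner_vec_def \<phi>_def)
    also have "\<dots> = (\<Sum>b\<in>Basis. (x \<bullet> b) * (y \<bullet> b))"
      by (rule sum.reindex_bij_betw[OF e])
    finally show ?thesis by (simp add: euclidean_inner[of x y])
  qed
  have dist: "dist (\<phi> x) (\<phi> y) = dist x y" for x y
    by (simp add: dist_norm norm_eq_sqrt_inner inner flip: linear_diff[OF lin])
  have "lborel = distr lborel borel \<phi>"
  proof (rule lborel_eqI)
    fix l u :: "real ^ 'a coord"
    assume lu: "\<And>b. b \<in> Basis \<Longrightarrow> l \<bullet> b \<le> u \<bullet> b"
    have le: "l $ i \<le> u $ i" for i
      using lu[of "axis i 1"] by (auto simp: inner_axis Basis_vec_def)
    define g where "g = inv_into UNIV e"
    have ge: "g (e i) = i" for i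
      using e by (simp add: g_def bij_betw_def)
    define l' u' where "l' = (\<Sum>b\<in>Basis. (l $ g b) *\<^sub>R b)" and "u' = (\<Sum>b\<in>Basis. (u $ g b) *\<^sub>R b)"
    have eB: "e i \<in> Basis" for i
      using e by (auto simp: bij_betw_def)
    have [simp]: "l' \<bullet> b = l $ g b" "u' \<bullet> b = u $ g b" if "b \<in> Basis" for b
      using that by (simp_all add: l'_def u'_def)
    have all_e: "(\<forall>b\<in>Basis. Q b) \<longleftrightarrow> (\<forall>i. Q (e i))" for Q
      using e by (metis bij_betw_imp_surj_on ball_UNIV image_iff rangeI)
    have vim: "\<phi> -` box l u = box l' u'"
      by (auto simp: mem_box_cart mem_box all_e \<phi>_def ge eB)
    have [measurable]: "\<phi> \<in> borel_measurable borel"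
      using lin by (intro borel_measurable_continuous_onI linear_continuous_on)
        (simp add: linear_linear)
    have "emeasure (distr lborel borel \<phi>) (box l u) = emeasure lborel (box l' u')"
      by (subst emeasure_distr) (simp_all add: vim)
    also have "\<dots> = (\<Prod>b\<in>Basis. (u' - l') \<bullet> b)"
      using le by (intro emeasure_lborel_box) simp
    also have "(\<Prod>b\<in>Basis. (u' - l') \<bullet> b) = (\<Prod>i\<in>UNIV. (u' - l') \<bullet> e i)"
      by (rule prod.reindex_bij_betw[OF e, symmetric])
    also have "\<dots> = (\<Prod>i\<in>UNIV. u $ i - l $ i)"
      by (simp add: inner_diff_left ge eB)
    also have "\<dots> = (\<Prod>b\<in>Basis. (u - l) \<bullet> b)"
    proof -
      have "bij_betw (\<lambda>i. axis i (1::real)) UNIV (Basis :: (real ^ 'a coord) set)"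
        by (auto simp: bij_betw_def Basis_vec_def inj_on_def axis_eq_axis)
      from prod.reindex_bij_betw[OF this, of "\<lambda>b. (u - l) \<bullet> b"] show ?thesis
        by (simp add: inner_axis)
    qed
    finally show "emeasure (distr lborel borel \<phi>) (box l u) = (\<Prod>b\<in>Basis. (u - l) \<bullet> b)" .
  qed simp
  with lin dist that show thesis by metis
qed

lemma content_convex_hull_isometric_image:
  fixes \<phi> :: "'a::euclidean_space \<Rightarrow> 'b::euclidean_space"
  assumes lin: "linear \<phi>" and iso: "\<And>x y. dist (\<phi> x) (\<phi> y) = dist x y"
    and mp: "distr lborel borel \<phi> = lborel" and "finite S"
  shows "measure lborel (convex hull (\<phi> ` S)) = simplex_volume S"
proof -
  have inj: "inj \<phi>"
    using iso by (metis dist_eq_0_iff injI)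
  have [measurable]: "\<phi> \<in> borel_measurable borel"
    using lin by (intro borel_measurable_continuous_onI linear_continuous_on)
      (simp add: linear_linear)
  have cpt: "compact (convex hull (\<phi> ` S))" "compact (convex hull S)"
    using \<open>finite S\<close> by (simp_all add: finite_imp_compact_convex_hull)
  have "measure lborel (convex hull (\<phi> ` S))
      = measure (distr lborel borel \<phi>) (convex hull (\<phi> ` S))"
    by (simp add: mp)
  also have "\<dots> = measure lborel (\<phi> -` (convex hull (\<phi> ` S)))"
    using cpt by (subst measure_distr) (auto dest: compact_imp_closed)
  also have "\<phi> -` (convex hull (\<phi> ` S)) = convex hull S"
    using inj by (simp add: convex_hull_linear_image[OF lin, symmetric] inj_vimage_image_eq)
  also have "measure lborel (convex hull S) = simplex_volume S"
    unfolding simplex_volume_def using cpt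
    by (intro measure_completion[symmetric]) (auto dest: compact_imp_closed)
  finally show ?thesis .
qed

section \<open>Products of simplex volumes\<close>

text \<open>Polarization for two vectors with different base points. Expanding the squared distances,
  the squared norms of the four points cancel and only the mixed inner products remain.\<close>
lemma inner_diff_diff_eq_dists:
  fixes x a y b :: "'a::real_inner"
  shows "(x - a) \<bullet> (y - b) = ((dist x b)\<^sup>2 + (dist a y)\<^sup>2 - (dist x y)\<^sup>2 - (dist a b)\<^sup>2) / 2"
  by (simp add: dist_norm power2_norm_eq_inner inner_diff_left inner_diff_right inner_commute)

lemma det_rational:
  fixes A :: "real ^ 'n ^ 'n"
  assumes "\<And>i j. A $ i $ j \<in> \<rat>"
  shows "det A \<in> \<rat>"
  unfolding det_def using assms by (intro Rats_sum Rats_prod Rats_mult) auto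

text \<open>The individual edge determinants are in general irrational; it is the mixed Gram matrix
  \<open>A\<^sup>T B\<close> that has rational entries.\<close>
lemma content_simplex_product_rational_cart:
  fixes X Y :: "(real ^ 'n :: {finite, wellorder}) set"
  assumes card: "card X = Suc CARD('n)" "card Y = Suc CARD('n)"
    and rat: "\<And>x y. x \<in> X \<Longrightarrow> y \<in> Y \<Longrightarrow> (dist x y)\<^sup>2 \<in> \<rat>"
  shows "measure lborel (convex hull X) * measure lborel (convex hull Y) \<in> \<rat>"
proof -
  have edges: "\<exists>z0\<in>Z. \<exists>f. bij_betw f (UNIV :: 'n set) (Z - {z0})"
    if "card Z = Suc CARD('n)" for Z :: "(real ^ 'n :: {finite, wellorder}) set"
  proof -
    from that have "finite Z" "Z \<noteq> {}" by (auto intro: card_ge_0_finite)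
    then obtain z0 where "z0 \<in> Z" by auto
    with that \<open>finite Z\<close> show ?thesis
      by (intro bexI[of _ z0] finite_same_card_bij) auto
  qed
  from edges[OF card(1)] obtain x0 f where x: "x0 \<in> X" "bij_betw f (UNIV :: 'n set) (X - {x0})"
    by auto
  from edges[OF card(2)] obtain y0 g where y: "y0 \<in> Y" "bij_betw g (UNIV :: 'n set) (Y - {y0})"
    by auto
  have fin: "finite X" "finite Y" using card by (auto intro: card_ge_0_finite)
  define A B :: "real ^ 'n :: {finite, wellorder} ^ 'n :: {finite, wellorder}" where "A = (\<chi> i. \<chi> j. f j $ i - x0 $ i)"
    and "B = (\<chi> i. \<chi> j. g j $ i - y0 $ i)"
  have "(transpose A ** B) $ i $ j \<in> \<rat>" for i j
  proof -
    have "(transpose A ** B) $ i $ j = (f i - x0) \<bullet> (g j - y0)"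
      by (simp add: matrix_matrix_mult_def transpose_def A_def B_def inner_vec_def)
    moreover have "f i \<in> X" "g j \<in> Y"
      using x y by (auto simp: bij_betw_def)
    ultimately show ?thesis
      using x(1) y(1) unfolding inner_diff_diff_eq_dists
      by (metis Rats_add Rats_diff Rats_divide Rats_number_of rat)
  qed
  then have "det (transpose A ** B) \<in> \<rat>" by (rule det_rational)
  then have "det A * det B \<in> \<rat>" by (simp add: det_mul)
  then have "\<bar>det A * det B\<bar> \<in> \<rat>" by (simp add: Rats_abs_iff)
  moreover have "measure lborel (convex hull X) * measure lborel (convex hull Y) =
     \<bar>det A * det B\<bar> / (fact CARD('n))\<^sup>2"
    unfolding content_simplex[OF fin(1) card(1) x] content_simplex[OF fin(2) card(2) y]
      A_def B_def by (simp add: power2_eq_square abs_mult)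
  moreover have "fact CARD('n) \<in> (\<rat> :: real set)"
    using Rats_of_nat by (metis of_nat_fact)
  ultimately show ?thesis by simp
qed

lemma simplex_volume_product_rational:
  fixes S T :: "'a::euclidean_space set"
  assumes card: "card S = DIM('a) + 1" "card T = DIM('a) + 1"
    and rat: "\<And>x y. x \<in> S \<Longrightarrow> y \<in> T \<Longrightarrow> (dist x y)\<^sup>2 \<in> \<rat>"
  shows "simplex_volume S * simplex_volume T \<in> \<rat>"
proof -
  obtain \<phi> :: "'a \<Rightarrow> real ^ 'a coord" where \<phi>: "linear \<phi>"
    "\<And>x y. dist (\<phi> x) (\<phi> y) = dist x y" "distr lborel borel \<phi> = lborel"
    using measure_preserving_coordinates by metis
  have inj: "inj_on \<phi> A" for A
    using \<phi>(2) by (metis dist_eq_0_iff inj_onI)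
  have fin: "finite S" "finite T" using card by (auto intro: card_ge_0_finite)
  have "measure lborel (convex hull (\<phi> ` S)) * measure lborel (convex hull (\<phi> ` T)) \<in> \<rat>"
    using card rat \<phi>(2)
    by (intro content_simplex_product_rational_cart) (auto simp: card_image[OF inj] card_coord)
  then show ?thesis
    using content_convex_hull_isometric_image[OF \<phi>] fin by simp
qed

section \<open>The common characteristic\<close>

text \<open>Writing \<open>x\<^sup>2 = a / b = a b / b\<^sup>2\<close> with natural numbers \<open>a, b\<close>, the squarefree part of \<open>a b\<close>
  is what remains under the root.\<close>
lemma square_rational_imp_rational_times_sqrt_squarefree:
  fixes x :: real
  assumes "x\<^sup>2 \<in> \<rat>" "x > 0"
  obtains k q where "squarefree (k::nat)" "q \<in> \<rat>" "x = q * sqrt (real k)"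
proof -
  obtain a b :: nat where ab: "b \<noteq> 0" "x\<^sup>2 = real a / real b"
    using Rats_abs_nat_div_natE[OF assms(1)] by (metis abs_power2)
  define k c where "k = squarefree_part (a * b)" and "c = square_part (a * b)"
  have "a * b = k * c\<^sup>2"
    unfolding k_def c_def by (rule squarefree_decompose)
  then have "real a * real b = real k * (real c)\<^sup>2"
    by (metis of_nat_mult of_nat_power)
  then have "x\<^sup>2 = (real c / real b * sqrt (real k))\<^sup>2"
    using ab by (simp add: power_mult_distrib power_divide power2_eq_square field_simps)
  then have "x = real c / real b * sqrt (real k)"
    using \<open>x > 0\<close> by (subst (asm) power2_eq_iff_nonneg) auto
  moreover have "squarefree k" unfolding k_def by (rule squarefree_squarefree_part)
  ultimately show thesis using that by (metis Rats_divide Rats_of_nat)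
qed

theorem theorem4:
  fixes P :: "'a::euclidean_space set"
  assumes "integral_point_set P"
    and "aff_dim P = int DIM('a)"
  shows "\<exists>k. \<forall>S\<subseteq>P. card S = DIM('a) + 1 \<and> simplex_volume S \<noteq> 0 \<longrightarrow>
           has_characteristic S k \<and> characteristic S = k"
proof (cases "\<exists>S\<subseteq>P. card S = DIM('a) + 1 \<and> simplex_volume S \<noteq> 0")
  case False
  then show ?thesis by blast
next
  case True
  then obtain S where S: "S \<subseteq> P" "card S = DIM('a) + 1" "simplex_volume S \<noteq> 0"
    by blast
  have rat: "(dist x y)\<^sup>2 \<in> \<rat>" if "x \<in> P" "y \<in> P" for x y
    using assms(1) that Ints_subset_Rats unfolding integral_point_set_def by (metis Rats_power subsetD)
  have prod: "simplex_volume S * simplex_volume T \<in> \<rat>" if "T \<subseteq> P" "card T = DIM('a) + 1" for T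
    using that S by (intro simplex_volume_product_rational rat) auto
  have "simplex_volume S > 0"
    using S(3) by (simp add: simplex_volume_def zero_less_measure_iff)
  moreover have sq: "(simplex_volume S)\<^sup>2 \<in> \<rat>"
    using prod[OF S(1,2)] by (simp add: power2_eq_square)
  ultimately obtain k q where k: "squarefree (k::nat)" "q \<in> \<rat>" "simplex_volume S = q * sqrt (real k)"
    using square_rational_imp_rational_times_sqrt_squarefree by blast
  have "has_characteristic T k" if T: "T \<subseteq> P" "card T = DIM('a) + 1" for T
  proof -
    define r where "r = simplex_volume S * simplex_volume T / (simplex_volume S)\<^sup>2"
    have "r \<in> \<rat>" unfolding r_def using prod[OF T] sq by simp
    moreover have "simplex_volume T = r * q * sqrt (real k)"
      using S(3) k(3) by (simp add: r_def power2_eq_square)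
    moreover have "k > 0" using k(1) by (auto intro: Nat.gr0I)
    ultimately show ?thesis
      using k(1,2) unfolding has_characteristic_def
      by (intro conjI bexI[of _ "r * q"] Rats_mult)
  qed
  then show ?thesis using characteristic_eqI by blast
qed

end
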